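(* Let $A$ be a finite nonempty set and $m\ge1$. (A) Let $\rho\subseteq A^m$ be a generalized quasiorder. Then $\rho^{\langle2\rangle}$ is an equivalence relation on $A$, $\rho/\rho^{\langle2\rangle}$ is a weak generalized partial order on $A/\rho^{\langle2\rangle}$, and $$\rho=\{(a_1,\dots,a_m)\in A^m\mid([a_1]_{\rho^{\langle2\rangle}},\dots,[a_m]_{\rho^{\langle2\rangle}})\in\rho/\rho^{\langle2\rangle}\}=\bigcup\{B_1\times\dots\times B_m\mid(B_1,\dots,B_m)\in\rho/\rho^{\langle2\rangle}\}.$$ (B) Let $\sigma$ be an equivalence relation on $A$ and let $\tau$ be an $m$-ary weak generalized partial order on $A/\sigma$. Then $$\rho:=\{(a_1,\dots,a_m)\in A^m\mid([a_1]_\sigma,\dots,[a_m]_\sigma)\in\tau\}=\bigcup\{B_1\times\dots\times B_m\mid(B_1,\dots,B_m)\in\tau\}$$ is a generalized quasiorder, $\rho^{\langle2\rangle}=\sigma$ and $\rho/\rho^{\langle2\rangle}=\tau$. (C) Let $\sigma$, $\tau$ and $\rho$ be as in (B). Then $\tau$ is a generalized partial order on $A/\sigma$ if and only if $\rho^{\langle2\rangle}=\rho^{[2]}$.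
   Context: For any finite nonempty set $X$, a relation $\rho\subseteq X^m$ is reflexive if $(a,\dots,a)\in\rho$ for all $a\in X$; it is (generalized) transitive if for every matrix $(a_{ij})\in X^{m\times m}$ all of whose rows and all of whose columns belong to $\rho$, the diagonal $(a_{11},\dots,a_{mm})$ belongs to $\rho$. A generalized quasiorder on $X$ is a reflexive and transitive relation. For $\rho\subseteq X^m$, elements $a,b\in X$ are exchangeable with respect to $\rho$ if for every $i\in\{1,\dots,m\}$ and all $a_1,\dots,a_{i-1},a_{i+1},\dots,a_m\in X$: $(a_1,\dots,a_{i-1},a,a_{i+1},\dots,a_m)\in\rho\iff(a_1,\dots,a_{i-1},b,a_{i+1},\dots,a_m)\in\rho$. The exchange equivalence is $\rho^{\langle2\rangle}:=\{(a,b)\in X^2\mid a,b\text{ exchangeable w.r.t. }\rho\}$. The binary symmetric part is $\rho^{[2]}:=\{(a,b)\in X^2\mid\{a,b\}^m\subseteq\rho\}$. A generalized quasiorder $\rho$ on $X$ is a weak generalized partial order if $\rho^{\langle2\rangle}=\Delta_X:=\{(a,a)\mid a\in X\}$, and a generalized partial order if $\rho^{[2]}=\Delta_X$. For an equivalence relation $\psi$ on $A$, $[a]_\psi$ is the $\psi$-class of $a$, $A/\psi$ the set of classes, and the factor relation is $\rho/\psi:=\{([a_1]_\psi,\dots,[a_m]_\psi)\mid(a_1,\dots,a_m)\in\rho\}\subseteq(A/\psi)^m$. *)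

theory Defs
  imports Main
begin

text \<open>
  An \<open>m\<close>-tuple over \<open>X\<close> is a list of length \<open>m\<close> with entries in \<open>X\<close>, so an \<open>m\<close>-ary relation on
  \<open>X\<close> is a subset of \<open>tuples X m\<close>. The base set \<open>X\<close> is an explicit carrier because the notions
  below are used both for a set and for the set of classes of an equivalence relation on it.
  Finiteness and nonemptiness of the base set are left to the theorems; both pass to
  quotient sets.
\<close>

definition tuples :: "'a set \<Rightarrow> nat \<Rightarrow> 'a list set" where
  "tuples X m = {xs. length xs = m \<and> set xs \<subseteq> X}"

definition gen_reflexive :: "'a set \<Rightarrow> nat \<Rightarrow> 'a list set \<Rightarrow> bool" where
  "gen_reflexive X m \<rho> \<longleftrightarrow> (\<forall>a\<in>X. replicate m a \<in> \<rho>)"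

text \<open>Matrices are functions of two indices, of which only the values at indices below \<open>m\<close> matter.\<close>

definition gen_transitive :: "'a set \<Rightarrow> nat \<Rightarrow> 'a list set \<Rightarrow> bool" where
  "gen_transitive X m \<rho> \<longleftrightarrow>
     (\<forall>M :: nat \<Rightarrow> nat \<Rightarrow> 'a.
        (\<forall>i<m. \<forall>j<m. M i j \<in> X) \<longrightarrow>
        (\<forall>i<m. map (\<lambda>j. M i j) [0..<m] \<in> \<rho>) \<longrightarrow>
        (\<forall>j<m. map (\<lambda>i. M i j) [0..<m] \<in> \<rho>) \<longrightarrow>
        map (\<lambda>i. M i i) [0..<m] \<in> \<rho>)"

definition gen_quasiorder :: "'a set \<Rightarrow> nat \<Rightarrow> 'a list set \<Rightarrow> bool" where
  "gen_quasiorder X m \<rho> \<longleftrightarrow>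
     \<rho> \<subseteq> tuples X m \<and> gen_reflexive X m \<rho> \<and> gen_transitive X m \<rho>"

text \<open>
  The lists \<open>us\<close> and \<open>vs\<close> are the entries before and after the varying position; as they range over
  all lists over \<open>X\<close> with \<open>m - 1\<close> entries altogether, all positions \<open>1, \<dots>, m\<close> are covered.
\<close>

definition exchangeable :: "'a set \<Rightarrow> nat \<Rightarrow> 'a list set \<Rightarrow> 'a \<Rightarrow> 'a \<Rightarrow> bool" where
  "exchangeable X m \<rho> a b \<longleftrightarrow>
     (\<forall>us vs. set us \<subseteq> X \<longrightarrow> set vs \<subseteq> X \<longrightarrow> length us + 1 + length vs = m \<longrightarrow>
        (us @ [a] @ vs \<in> \<rho> \<longleftrightarrow> us @ [b] @ vs \<in> \<rho>))"

definition exchange_equiv :: "'a set \<Rightarrow> nat \<Rightarrow> 'a list set \<Rightarrow> ('a \<times> 'a) set" where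
  "exchange_equiv X m \<rho> = {(a, b). a \<in> X \<and> b \<in> X \<and> exchangeable X m \<rho> a b}"

definition binary_symmetric_part :: "'a set \<Rightarrow> nat \<Rightarrow> 'a list set \<Rightarrow> ('a \<times> 'a) set" where
  "binary_symmetric_part X m \<rho> = {(a, b). a \<in> X \<and> b \<in> X \<and> tuples {a, b} m \<subseteq> \<rho>}"

definition weak_gen_partial_order :: "'a set \<Rightarrow> nat \<Rightarrow> 'a list set \<Rightarrow> bool" where
  "weak_gen_partial_order X m \<rho> \<longleftrightarrow> gen_quasiorder X m \<rho> \<and> exchange_equiv X m \<rho> = Id_on X"

definition gen_partial_order :: "'a set \<Rightarrow> nat \<Rightarrow> 'a list set \<Rightarrow> bool" where
  "gen_partial_order X m \<rho> \<longleftrightarrow> gen_quasiorder X m \<rho> \<and> binary_symmetric_part X m \<rho> = Id_on X"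

definition classes :: "('a \<times> 'a) set \<Rightarrow> 'a list \<Rightarrow> 'a set list" where
  "classes \<psi> xs = map (\<lambda>a. \<psi> `` {a}) xs"

definition factor_rel :: "'a list set \<Rightarrow> ('a \<times> 'a) set \<Rightarrow> 'a set list set" where
  "factor_rel \<rho> \<psi> = {classes \<psi> xs | xs. xs \<in> \<rho>}"

end

theory Submission
  imports Defs
begin

text \<open>
  Exchanging the entries of a tuple one at a time shows that a relation is saturated for its own
  exchange equivalence. So (A), like (B) and (C), concerns the preimage \<open>\<rho>\<close> of a relation \<open>\<tau>\<close>
  under \<open>A \<rightarrow> A/\<sigma>\<close>. As this map is onto, being a generalized quasiorder, exchangeability and the
  binary symmetric part all transfer between \<open>\<rho>\<close> and \<open>\<tau>\<close>; a relation on \<open>A\<close> compatible with one on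
  \<open>A/\<sigma>\<close> is \<open>\<sigma>\<close> exactly if the latter is the identity.
\<close>

section \<open>Tuples of equivalence classes\<close>

lemma classes_simps [simp]:
  "classes \<psi> [] = []"
  "classes \<psi> (x # xs) = \<psi> `` {x} # classes \<psi> xs"
  "classes \<psi> (xs @ ys) = classes \<psi> xs @ classes \<psi> ys"
  "classes \<psi> (replicate m x) = replicate m (\<psi> `` {x})"
  "length (classes \<psi> xs) = length xs"
  by (simp_all add: classes_def)

lemma classes_map: "classes \<psi> (map f xs) = map (\<lambda>x. \<psi> `` {f x}) xs"
  by (simp add: classes_def)

lemma classes_image_lists: "classes \<psi> ` lists X = lists ((\<lambda>a. \<psi> `` {a}) ` X)"
  unfolding classes_def by (simp add: lists_image)

text \<open>With the quotient written as an image, a quantifier over classes becomes a quantifier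
  over representatives in \<open>A\<close>.\<close>

lemma quotient_eq_image: "A // \<sigma> = (\<lambda>a. \<sigma> `` {a}) ` A"
  by (auto simp: quotient_def)

lemma tuples_eq_lists: "tuples X m = {xs \<in> lists X. length xs = m}"
  by (auto simp: tuples_def)

text \<open>Lists over an image are images of lists, and \<open>classes\<close> preserves length.
  For \<open>X = A\<close> this says that the class map is onto on tuples; for
  \<open>X = {a, b}\<close> it serves the binary symmetric part.\<close>

lemma classes_image_tuples: "classes \<psi> ` tuples X m = tuples ((\<lambda>a. \<psi> `` {a}) ` X) m"
proof -
  have "classes \<psi> ` tuples X m = {Bs \<in> classes \<psi> ` lists X. length Bs = m}"
    by (auto simp: tuples_eq_lists)
  then show ?thesis
    by (simp add: classes_image_lists tuples_eq_lists)
qed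

lemma classes_in_tuples: "xs \<in> tuples A m \<Longrightarrow> classes \<sigma> xs \<in> tuples (A // \<sigma>) m"
  unfolding quotient_eq_image classes_image_tuples [symmetric] by blast

text \<open>The form with \<open>list_all2\<close> allows an induction that exchanges one entry
  after the other.\<close>

lemma classes_eq_iff:
  assumes "equiv A \<sigma>" "set xs \<subseteq> A" "set ys \<subseteq> A"
  shows "classes \<sigma> xs = classes \<sigma> ys \<longleftrightarrow> list_all2 (\<lambda>x y. (x, y) \<in> \<sigma>) xs ys"
  using assms(2,3)
proof (induction xs arbitrary: ys)
  case Nil
  then show ?case by (cases ys) auto
next
  case (Cons x xs)
  then show ?case
    by (cases ys) (auto simp: eq_equiv_class_iff [OF assms(1)])
qed

text \<open>\<open>listset\<close> is the Cartesian product of a list of sets, so a product of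
  classes is a fibre of the class map.\<close>

lemma listset_classes_iff:
  assumes "equiv A \<sigma>" "set ys \<subseteq> A"
  shows "xs \<in> listset (classes \<sigma> ys) \<longleftrightarrow> set xs \<subseteq> A \<and> classes \<sigma> xs = classes \<sigma> ys"
  using assms(2)
proof (induction ys arbitrary: xs)
  case Nil
  then show ?case by (cases xs) auto
next
  case (Cons y ys)
  have "x \<in> \<sigma> `` {y} \<longleftrightarrow> x \<in> A \<and> \<sigma> `` {x} = \<sigma> `` {y}" for x
    using assms(1) Cons.prems equiv_class_eq_iff [OF assms(1), of y x] by auto
  then show ?case
    using Cons by (cases xs) (auto simp: set_Cons_def)
qed

section \<open>Saturation under the exchange equivalence\<close>

lemma equiv_exchange_equiv: "equiv X (exchange_equiv X m \<rho>)"
  by (rule equivI)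
    (auto simp: exchange_equiv_def exchangeable_def refl_on_def sym_def trans_def)

text \<open>The prefix \<open>us\<close> collects the entries already exchanged: each induction step
  replaces the head of \<open>xs\<close> and moves the new entry to the end of the prefix, so the
  total length stays \<open>m\<close>.\<close>

lemma exchange_equiv_swap:
  assumes "list_all2 (\<lambda>x y. (x, y) \<in> exchange_equiv X m \<rho>) xs ys"
    and "set us \<subseteq> X" "length us + length xs = m"
  shows "us @ xs \<in> \<rho> \<longleftrightarrow> us @ ys \<in> \<rho>"
  using assms
proof (induction arbitrary: us rule: list_all2_induct)
  case Nil
  then show ?case by simp
next
  case (Cons x xs y ys)
  have xy: "x \<in> X" "y \<in> X" "exchangeable X m \<rho> x y"
    using Cons.hyps by (auto simp: exchange_equiv_def)
  \<comment> \<open>\<open>exchangeable\<close> speaks only of contexts with entries in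
    \<open>X\<close>.\<close>
  have "set xs \<subseteq> X"
    using Cons.hyps by (auto simp: exchange_equiv_def list_all2_conv_all_nth in_set_conv_nth)
  then have "us @ [x] @ xs \<in> \<rho> \<longleftrightarrow> us @ [y] @ xs \<in> \<rho>"
    using xy Cons.prems unfolding exchangeable_def by auto
  also have "\<dots> \<longleftrightarrow> (us @ [y]) @ ys \<in> \<rho>"
    using Cons.IH [of "us @ [y]"] Cons.prems xy by simp
  finally show ?case by simp
qed

text \<open>A tuple of classes in the factor relation comes from some \<open>ys\<close> in
  \<open>\<rho>\<close>. The entries of \<open>xs\<close> and \<open>ys\<close> are pairwise
  exchangeable, so \<open>ys\<close> can be turned into \<open>xs\<close> without leaving
  \<open>\<rho>\<close>.\<close>

lemma factor_exchange_equiv_iff: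
  assumes "\<rho> \<subseteq> tuples X m" "xs \<in> tuples X m"
  shows "classes (exchange_equiv X m \<rho>) xs \<in> factor_rel \<rho> (exchange_equiv X m \<rho>) \<longleftrightarrow> xs \<in> \<rho>"
proof
  assume "classes (exchange_equiv X m \<rho>) xs \<in> factor_rel \<rho> (exchange_equiv X m \<rho>)"
  then obtain ys where ys: "ys \<in> \<rho>"
    "classes (exchange_equiv X m \<rho>) xs = classes (exchange_equiv X m \<rho>) ys"
    by (auto simp: factor_rel_def)
  moreover have "set xs \<subseteq> X" "length xs = m" "set ys \<subseteq> X"
    using assms ys by (auto simp: tuples_def)
  ultimately have "list_all2 (\<lambda>x y. (x, y) \<in> exchange_equiv X m \<rho>) xs ys"
    using classes_eq_iff [OF equiv_exchange_equiv] by blast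
  then show "xs \<in> \<rho>"
    using exchange_equiv_swap [of X m \<rho> xs ys "[]"] ys \<open>length xs = m\<close> by simp
qed (auto simp: factor_rel_def)

section \<open>Preimages under the map to classes\<close>

text \<open>The common setting of all three claims. Being a generalized quasiorder is not assumed:
  in (A) it is known of \<open>\<rho>\<close>, in (B) of \<open>\<tau>\<close>, and it is
  transferred from there to the other relation.\<close>

locale class_pullback =
  fixes A :: "'a set" and m :: nat and \<sigma> :: "('a \<times> 'a) set"
    and \<tau> :: "'a set list set" and \<rho> :: "'a list set"
  assumes equiv: "equiv A \<sigma>"
    and tau_tuples: "\<tau> \<subseteq> tuples (A // \<sigma>) m"
    and rho_eq: "\<rho> = {xs \<in> tuples A m. classes \<sigma> xs \<in> \<tau>}"
begin

lemma rho_tuples: "\<rho> \<subseteq> tuples A m"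
  by (auto simp: rho_eq)

lemma in_rho_iff: "xs \<in> tuples A m \<Longrightarrow> xs \<in> \<rho> \<longleftrightarrow> classes \<sigma> xs \<in> \<tau>"
  by (simp add: rho_eq)

text \<open>Since the class map is onto on tuples, the image of the preimage of
  \<open>\<tau>\<close> is all of \<open>\<tau>\<close>.\<close>

lemma factor_rel_eq: "factor_rel \<rho> \<sigma> = \<tau>"
proof -
  have "\<tau> \<subseteq> classes \<sigma> ` tuples A m"
    using tau_tuples by (simp add: classes_image_tuples quotient_eq_image)
  then show ?thesis
    by (auto simp: factor_rel_def rho_eq)
qed

text \<open>Each member of \<open>\<tau>\<close> is the class tuple of some \<open>ys\<close> in
  \<open>\<rho>\<close>, and the product of its classes is the fibre over it. The preimage
  \<open>\<rho>\<close> is the union of these fibres.\<close>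

lemma rho_eq_Union: "\<rho> = \<Union> {listset Bs | Bs. Bs \<in> \<tau>}"
proof (rule set_eqI)
  fix xs
  have listset_iff: "xs \<in> listset (classes \<sigma> ys) \<longleftrightarrow> xs \<in> tuples A m \<and> classes \<sigma> xs = classes \<sigma> ys"
    if ys: "ys \<in> tuples A m" for ys
  proof -
    have "length xs = length ys" if "classes \<sigma> xs = classes \<sigma> ys"
      using arg_cong [OF that, of length] by simp
    then show ?thesis
      using ys listset_classes_iff [OF equiv, of ys xs] by (auto simp: tuples_def)
  qed
  have "xs \<in> \<Union> {listset Bs | Bs. Bs \<in> \<tau>} \<longleftrightarrow> (\<exists>ys \<in> \<rho>. xs \<in> listset (classes \<sigma> ys))"
    unfolding factor_rel_eq [symmetric] by (auto simp: factor_rel_def)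
  also have "\<dots> \<longleftrightarrow> xs \<in> tuples A m \<and> (\<exists>ys \<in> \<rho>. classes \<sigma> xs = classes \<sigma> ys)"
    using listset_iff rho_tuples by blast
  also have "\<dots> \<longleftrightarrow> xs \<in> \<rho>"
    by (auto simp: rho_eq)
  finally show "xs \<in> \<rho> \<longleftrightarrow> xs \<in> \<Union> {listset Bs | Bs. Bs \<in> \<tau>}"
    by simp
qed

section \<open>Transfer of properties between \<open>\<rho>\<close> and
  \<open>\<tau>\<close>\<close>

lemma gen_reflexive_iff: "gen_reflexive A m \<rho> \<longleftrightarrow> gen_reflexive (A // \<sigma>) m \<tau>"
proof -
  have "replicate m a \<in> tuples A m" if "a \<in> A" for a
    using that by (auto simp: tuples_def)
  then show ?thesis
    by (simp add: gen_reflexive_def quotient_eq_image in_rho_iff)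
qed

text \<open>Matrices over \<open>A\<close> are pushed down entrywise to classes; matrices of classes
  are lifted entrywise to representatives.\<close>

lemma gen_transitive_iff: "gen_transitive A m \<rho> \<longleftrightarrow> gen_transitive (A // \<sigma>) m \<tau>"
proof
  assume trans: "gen_transitive (A // \<sigma>) m \<tau>"
  show "gen_transitive A m \<rho>"
    unfolding gen_transitive_def
  proof (intro allI impI)
    fix M :: "nat \<Rightarrow> nat \<Rightarrow> 'a"
    assume M: "\<forall>i<m. \<forall>j<m. M i j \<in> A"
      and rows: "\<forall>i<m. map (\<lambda>j. M i j) [0..<m] \<in> \<rho>"
      and cols: "\<forall>j<m. map (\<lambda>i. M i j) [0..<m] \<in> \<rho>"
    have "\<forall>i<m. \<forall>j<m. \<sigma> `` {M i j} \<in> A // \<sigma>"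
      using M by (auto intro: quotientI)
    moreover have "\<forall>i<m. map (\<lambda>j. \<sigma> `` {M i j}) [0..<m] \<in> \<tau>"
      using rows by (simp add: rho_eq classes_map)
    moreover have "\<forall>j<m. map (\<lambda>i. \<sigma> `` {M i j}) [0..<m] \<in> \<tau>"
      using cols by (simp add: rho_eq classes_map)
    ultimately have "map (\<lambda>i. \<sigma> `` {M i i}) [0..<m] \<in> \<tau>"
      using trans [unfolded gen_transitive_def, rule_format, of "\<lambda>i j. \<sigma> `` {M i j}"] by simp
    moreover have "map (\<lambda>i. M i i) [0..<m] \<in> tuples A m"
      using M by (auto simp: tuples_def)
    ultimately show "map (\<lambda>i. M i i) [0..<m] \<in> \<rho>"
      by (simp add: in_rho_iff classes_map)
  qed
next
  assume trans: "gen_transitive A m \<rho>"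
  show "gen_transitive (A // \<sigma>) m \<tau>"
    unfolding gen_transitive_def
  proof (intro allI impI)
    fix M :: "nat \<Rightarrow> nat \<Rightarrow> 'a set"
    assume M: "\<forall>i<m. \<forall>j<m. M i j \<in> A // \<sigma>"
      and rows: "\<forall>i<m. map (\<lambda>j. M i j) [0..<m] \<in> \<tau>"
      and cols: "\<forall>j<m. map (\<lambda>i. M i j) [0..<m] \<in> \<tau>"
    \<comment> \<open>One representative \<open>r B\<close> is fixed per class, so a single function
      lifts rows, columns and diagonal alike.\<close>
    have "\<forall>B \<in> A // \<sigma>. \<exists>x. x \<in> A \<and> \<sigma> `` {x} = B"
      by (auto simp: quotient_eq_image)
    then obtain r where r: "\<And>B. B \<in> A // \<sigma> \<Longrightarrow> r B \<in> A \<and> \<sigma> `` {r B} = B"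
      by metis
    have rep: "map (\<lambda>k. r (f k)) [0..<m] \<in> \<rho> \<longleftrightarrow> map f [0..<m] \<in> \<tau>"
      if "\<forall>k<m. f k \<in> A // \<sigma>" for f
    proof -
      have "map (\<lambda>k. r (f k)) [0..<m] \<in> tuples A m"
        using that r by (auto simp: tuples_def)
      moreover have "map (\<lambda>k. \<sigma> `` {r (f k)}) [0..<m] = map f [0..<m]"
        using that r by simp
      ultimately show ?thesis
        by (simp only: in_rho_iff classes_map)
    qed
    have "\<forall>i<m. \<forall>j<m. r (M i j) \<in> A"
      using M r by blast
    moreover have "\<forall>i<m. map (\<lambda>j. r (M i j)) [0..<m] \<in> \<rho>"
      using rows M by (simp add: rep)
    moreover have "\<forall>j<m. map (\<lambda>i. r (M i j)) [0..<m] \<in> \<rho>"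
      using cols M by (simp add: rep)
    ultimately have "map (\<lambda>i. r (M i i)) [0..<m] \<in> \<rho>"
      using trans [unfolded gen_transitive_def, rule_format, of "\<lambda>i j. r (M i j)"] by simp
    then show "map (\<lambda>i. M i i) [0..<m] \<in> \<tau>"
      using M by (simp add: rep)
  qed
qed

lemma gen_quasiorder_iff: "gen_quasiorder A m \<rho> \<longleftrightarrow> gen_quasiorder (A // \<sigma>) m \<tau>"
  using rho_tuples tau_tuples gen_reflexive_iff gen_transitive_iff
  by (simp add: gen_quasiorder_def)

text \<open>The contexts over \<open>A // \<sigma>\<close> are exactly the class lists of the
  contexts over \<open>A\<close>, so both conditions test the same memberships.\<close>

lemma exchangeable_iff:
  assumes "a \<in> A" "b \<in> A"
  shows "exchangeable A m \<rho> a b \<longleftrightarrow> exchangeable (A // \<sigma>) m \<tau> (\<sigma> `` {a}) (\<sigma> `` {b})"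
proof -
  have "exchangeable (A // \<sigma>) m \<tau> (\<sigma> `` {a}) (\<sigma> `` {b}) \<longleftrightarrow>
      (\<forall>Us \<in> lists (A // \<sigma>). \<forall>Vs \<in> lists (A // \<sigma>). length Us + 1 + length Vs = m \<longrightarrow>
        (Us @ [\<sigma> `` {a}] @ Vs \<in> \<tau> \<longleftrightarrow> Us @ [\<sigma> `` {b}] @ Vs \<in> \<tau>))"
    by (auto simp: exchangeable_def lists_eq_set)
  also have "\<dots> \<longleftrightarrow>
      (\<forall>us \<in> lists A. \<forall>vs \<in> lists A. length us + 1 + length vs = m \<longrightarrow>
        (classes \<sigma> (us @ [a] @ vs) \<in> \<tau> \<longleftrightarrow> classes \<sigma> (us @ [b] @ vs) \<in> \<tau>))"
    unfolding quotient_eq_image classes_image_lists [symmetric] by simp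
  also have "\<dots> \<longleftrightarrow>
      (\<forall>us \<in> lists A. \<forall>vs \<in> lists A. length us + 1 + length vs = m \<longrightarrow>
        (us @ [a] @ vs \<in> \<rho> \<longleftrightarrow> us @ [b] @ vs \<in> \<rho>))"
  proof -
    have "us @ [c] @ vs \<in> tuples A m"
      if "us \<in> lists A" "vs \<in> lists A" "length us + 1 + length vs = m" "c \<in> A" for us vs c
      using that by (auto simp: tuples_def)
    then have "us @ [c] @ vs \<in> \<rho> \<longleftrightarrow> classes \<sigma> (us @ [c] @ vs) \<in> \<tau>"
      if "us \<in> lists A" "vs \<in> lists A" "length us + 1 + length vs = m" "c \<in> A" for us vs c
      using that by (intro in_rho_iff)
    then show ?thesis
      using assms by (intro ball_cong imp_cong refl) presburger
  qed
  also have "\<dots> \<longleftrightarrow> exchangeable A m \<rho> a b"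
    by (auto simp: exchangeable_def lists_eq_set)
  finally show ?thesis by simp
qed

lemma exchange_equiv_iff:
  "a \<in> A \<Longrightarrow> b \<in> A \<Longrightarrow>
    (a, b) \<in> exchange_equiv A m \<rho> \<longleftrightarrow> (\<sigma> `` {a}, \<sigma> `` {b}) \<in> exchange_equiv (A // \<sigma>) m \<tau>"
  by (simp add: exchange_equiv_def exchangeable_iff quotientI)

text \<open>The class map sends the tuples over \<open>{a, b}\<close> onto the tuples over the two
  classes, also when these classes coincide.\<close>

lemma binary_symmetric_part_iff:
  assumes "a \<in> A" "b \<in> A"
  shows "(a, b) \<in> binary_symmetric_part A m \<rho> \<longleftrightarrow>
    (\<sigma> `` {a}, \<sigma> `` {b}) \<in> binary_symmetric_part (A // \<sigma>) m \<tau>"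
proof -
  have "tuples {a, b} m \<subseteq> tuples A m"
    using assms by (auto simp: tuples_def)
  then have "tuples {a, b} m \<subseteq> \<rho> \<longleftrightarrow> classes \<sigma> ` tuples {a, b} m \<subseteq> \<tau>"
    by (auto simp: rho_eq)
  then have "tuples {a, b} m \<subseteq> \<rho> \<longleftrightarrow> tuples {\<sigma> `` {a}, \<sigma> `` {b}} m \<subseteq> \<tau>"
    by (simp add: classes_image_tuples)
  then show ?thesis
    using assms by (simp add: binary_symmetric_part_def quotientI)
qed

section \<open>Comparison with \<open>\<sigma>\<close> and with the identity\<close>

text \<open>Two elements of \<open>A\<close> are related by \<open>\<sigma>\<close> exactly if their
  classes are equal, so \<open>\<sigma>\<close> itself corresponds to the identity on classes.
  Stated for arbitrary \<open>R\<close> and \<open>S\<close> to cover both the exchange equivalence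
  and the binary symmetric part.\<close>

lemma eq_sigma_iff_eq_Id_on:
  assumes "R \<subseteq> A \<times> A" "S \<subseteq> (A // \<sigma>) \<times> (A // \<sigma>)"
    and RS: "\<And>a b. a \<in> A \<Longrightarrow> b \<in> A \<Longrightarrow> (a, b) \<in> R \<longleftrightarrow> (\<sigma> `` {a}, \<sigma> `` {b}) \<in> S"
  shows "R = \<sigma> \<longleftrightarrow> S = Id_on (A // \<sigma>)"
proof -
  have "\<sigma> \<subseteq> A \<times> A"
    using equiv by (rule equiv_type)
  then have "R = \<sigma> \<longleftrightarrow> (\<forall>a\<in>A. \<forall>b\<in>A. (a, b) \<in> R \<longleftrightarrow> (a, b) \<in> \<sigma>)"
    using assms(1) by blast
  also have "\<dots> \<longleftrightarrow> (\<forall>a\<in>A. \<forall>b\<in>A. (\<sigma> `` {a}, \<sigma> `` {b}) \<in> S \<longleftrightarrow> \<sigma> `` {a} = \<sigma> `` {b})"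
    using RS eq_equiv_class_iff [OF equiv] by simp
  also have "\<dots> \<longleftrightarrow> (\<forall>B\<in>A // \<sigma>. \<forall>C\<in>A // \<sigma>. (B, C) \<in> S \<longleftrightarrow> B = C)"
    by (simp add: quotient_eq_image)
  also have "\<dots> \<longleftrightarrow> S = Id_on (A // \<sigma>)"
    using assms(2) by auto
  finally show ?thesis .
qed

lemma exchange_equiv_eq_iff:
  "exchange_equiv A m \<rho> = \<sigma> \<longleftrightarrow> exchange_equiv (A // \<sigma>) m \<tau> = Id_on (A // \<sigma>)"
proof (rule eq_sigma_iff_eq_Id_on)
  show "exchange_equiv A m \<rho> \<subseteq> A \<times> A"
    "exchange_equiv (A // \<sigma>) m \<tau> \<subseteq> (A // \<sigma>) \<times> (A // \<sigma>)"
    by (auto simp: exchange_equiv_def)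
qed (rule exchange_equiv_iff)

lemma binary_symmetric_part_eq_iff:
  "binary_symmetric_part A m \<rho> = \<sigma> \<longleftrightarrow> binary_symmetric_part (A // \<sigma>) m \<tau> = Id_on (A // \<sigma>)"
proof (rule eq_sigma_iff_eq_Id_on)
  show "binary_symmetric_part A m \<rho> \<subseteq> A \<times> A"
    "binary_symmetric_part (A // \<sigma>) m \<tau> \<subseteq> (A // \<sigma>) \<times> (A // \<sigma>)"
    by (auto simp: binary_symmetric_part_def)
qed (rule binary_symmetric_part_iff)

text \<open>Read from right to left this yields (A), from left to right (B).\<close>

lemma weak_gen_partial_order_iff:
  "weak_gen_partial_order (A // \<sigma>) m \<tau> \<longleftrightarrow> gen_quasiorder A m \<rho> \<and> exchange_equiv A m \<rho> = \<sigma>"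
  by (simp add: weak_gen_partial_order_def gen_quasiorder_iff exchange_equiv_eq_iff)

lemma gen_partial_order_iff:
  "gen_partial_order (A // \<sigma>) m \<tau> \<longleftrightarrow> gen_quasiorder A m \<rho> \<and> binary_symmetric_part A m \<rho> = \<sigma>"
  by (simp add: gen_partial_order_def gen_quasiorder_iff binary_symmetric_part_eq_iff)

end

section \<open>Derivation of the three claims\<close>

text \<open>Saturation makes \<open>\<rho>\<close> the preimage of its own factor relation, which
  brings (A) into the setting of the locale.\<close>

lemma class_pullback_exchange_equiv:
  assumes "\<rho> \<subseteq> tuples A m"
  shows "class_pullback A m (exchange_equiv A m \<rho>) (factor_rel \<rho> (exchange_equiv A m \<rho>)) \<rho>"
proof
  show "equiv A (exchange_equiv A m \<rho>)"
    by (rule equiv_exchange_equiv)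
  show "factor_rel \<rho> (exchange_equiv A m \<rho>) \<subseteq> tuples (A // exchange_equiv A m \<rho>) m"
    using assms by (auto simp: factor_rel_def intro: classes_in_tuples)
  show "\<rho> = {xs \<in> tuples A m.
      classes (exchange_equiv A m \<rho>) xs \<in> factor_rel \<rho> (exchange_equiv A m \<rho>)}"
    using assms factor_exchange_equiv_iff by blast
qed

theorem theorem4p8:
  fixes A :: "'a set" and m :: nat
  assumes "finite A" and "A \<noteq> {}" and "m \<ge> 1"
  shows
    "(\<forall>\<rho>. gen_quasiorder A m \<rho> \<longrightarrow>
        equiv A (exchange_equiv A m \<rho>) \<and>
        weak_gen_partial_order (A // exchange_equiv A m \<rho>) m (factor_rel \<rho> (exchange_equiv A m \<rho>)) \<and>
        \<rho> = {xs \<in> tuples A m.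
               classes (exchange_equiv A m \<rho>) xs \<in> factor_rel \<rho> (exchange_equiv A m \<rho>)} \<and>
        \<rho> = \<Union> {listset Bs | Bs. Bs \<in> factor_rel \<rho> (exchange_equiv A m \<rho>)})
     \<and>
     (\<forall>\<sigma> \<tau> \<rho>. equiv A \<sigma> \<longrightarrow> weak_gen_partial_order (A // \<sigma>) m \<tau> \<longrightarrow>
        \<rho> = {xs \<in> tuples A m. classes \<sigma> xs \<in> \<tau>} \<longrightarrow>
        \<rho> = \<Union> {listset Bs | Bs. Bs \<in> \<tau>} \<and>
        gen_quasiorder A m \<rho> \<and>
        exchange_equiv A m \<rho> = \<sigma> \<and>
        factor_rel \<rho> (exchange_equiv A m \<rho>) = \<tau>)
     \<and>
     (\<forall>\<sigma> \<tau> \<rho>. equiv A \<sigma> \<longrightarrow> weak_gen_partial_order (A // \<sigma>) m \<tau> \<longrightarrow>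
        \<rho> = {xs \<in> tuples A m. classes \<sigma> xs \<in> \<tau>} \<longrightarrow>
        (gen_partial_order (A // \<sigma>) m \<tau> \<longleftrightarrow>
         exchange_equiv A m \<rho> = binary_symmetric_part A m \<rho>))"
proof (intro conjI allI impI)
  fix \<rho>
  assume quasi: "gen_quasiorder A m \<rho>"
  then interpret class_pullback A m "exchange_equiv A m \<rho>" "factor_rel \<rho> (exchange_equiv A m \<rho>)" \<rho>
    by (intro class_pullback_exchange_equiv) (simp add: gen_quasiorder_def)
  show "equiv A (exchange_equiv A m \<rho>)"
    by (rule equiv)
  show "weak_gen_partial_order (A // exchange_equiv A m \<rho>) m (factor_rel \<rho> (exchange_equiv A m \<rho>))"
    \<comment> \<open>Here \<open>\<sigma>\<close> is the exchange equivalence itself, so the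
      condition on it in \<open>weak_gen_partial_order_iff\<close> is trivially true.\<close>
    using quasi by (simp add: weak_gen_partial_order_iff)
  show "\<rho> = {xs \<in> tuples A m.
      classes (exchange_equiv A m \<rho>) xs \<in> factor_rel \<rho> (exchange_equiv A m \<rho>)}"
    by (rule rho_eq)
  show "\<rho> = \<Union> {listset Bs | Bs. Bs \<in> factor_rel \<rho> (exchange_equiv A m \<rho>)}"
    by (rule rho_eq_Union)
next
  fix \<sigma> \<tau> \<rho>
  assume asms: "equiv A \<sigma>" "weak_gen_partial_order (A // \<sigma>) m \<tau>"
    "\<rho> = {xs \<in> tuples A m. classes \<sigma> xs \<in> \<tau>}"
  then interpret class_pullback A m \<sigma> \<tau> \<rho>
    by unfold_locales (auto simp: weak_gen_partial_order_def gen_quasiorder_def)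
  show "\<rho> = \<Union> {listset Bs | Bs. Bs \<in> \<tau>}"
    by (rule rho_eq_Union)
  show "gen_quasiorder A m \<rho>" and "exchange_equiv A m \<rho> = \<sigma>"
    using asms(2) by (simp_all add: weak_gen_partial_order_iff)
  then show "factor_rel \<rho> (exchange_equiv A m \<rho>) = \<tau>"
    by (simp add: factor_rel_eq)
next
  fix \<sigma> \<tau> \<rho>
  assume asms: "equiv A \<sigma>" "weak_gen_partial_order (A // \<sigma>) m \<tau>"
    "\<rho> = {xs \<in> tuples A m. classes \<sigma> xs \<in> \<tau>}"
  then interpret class_pullback A m \<sigma> \<tau> \<rho>
    by unfold_locales (auto simp: weak_gen_partial_order_def gen_quasiorder_def)
  show "gen_partial_order (A // \<sigma>) m \<tau> \<longleftrightarrow>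
      exchange_equiv A m \<rho> = binary_symmetric_part A m \<rho>"
    \<comment> \<open>The weak order gives \<open>exchange_equiv A m \<rho> = \<sigma>\<close>, so
      both sides say that the binary symmetric part of \<open>\<rho>\<close> is
      \<open>\<sigma>\<close>.\<close>
    using asms(2) by (auto simp: weak_gen_partial_order_iff gen_partial_order_iff)
qed

end
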